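(* Let $R\to S$ be a flat ring homomorphism of Noetherian rings and let $E$ be an $R$-module. Then $$\min\nolimits_S(E\otimes_R S)=\bigcup_{\mathfrak p\in\min_R E}\min\nolimits_S(S/\mathfrak pS).$$
   Context: All rings are commutative with unity; modules are arbitrary. For a module $E$ over a ring $A$, $\min_A E$ denotes the set of minimal elements (under inclusion) of $\operatorname{Ass}_A E$. *)

theory Defs
  imports
    "HOL-Algebra.Module"
    "HOL-Algebra.QuotRing"
    "HOL-Algebra.Ring_Divisibility"
    "HOL-Algebra.Free_Abelian_Groups"
begin

section \<open>Associated primes\<close>

definition annihilator :: "('a, 'm) ring_scheme \<Rightarrow> ('a, 'e, 'n) module_scheme \<Rightarrow> 'e \<Rightarrow> 'a set"
  where "annihilator A E x = {a \<in> carrier A. a \<odot>\<^bsub>E\<^esub> x = \<zero>\<^bsub>E\<^esub>}"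

definition Ass :: "('a, 'm) ring_scheme \<Rightarrow> ('a, 'e, 'n) module_scheme \<Rightarrow> 'a set set"
  where "Ass A E = {P. primeideal P A \<and> (\<exists>x \<in> carrier E. P = annihilator A E x)}"

definition min_Ass :: "('a, 'm) ring_scheme \<Rightarrow> ('a, 'e, 'n) module_scheme \<Rightarrow> 'a set set"
  where "min_Ass A E = {P \<in> Ass A E. \<forall>Q \<in> Ass A E. Q \<subseteq> P \<longrightarrow> Q = P}"


section \<open>Module homomorphisms; rings as modules\<close>

definition mod_hom ::
  "('a, 'm) ring_scheme \<Rightarrow> ('a, 'e, 'n) module_scheme \<Rightarrow> ('a, 'f, 'k) module_scheme \<Rightarrow> ('e \<Rightarrow> 'f) set"
  where "mod_hom A M N =
    {f \<in> carrier M \<rightarrow> carrier N.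
       (\<forall>x \<in> carrier M. \<forall>y \<in> carrier M. f (x \<oplus>\<^bsub>M\<^esub> y) = f x \<oplus>\<^bsub>N\<^esub> f y) \<and>
       (\<forall>a \<in> carrier A. \<forall>x \<in> carrier M. f (a \<odot>\<^bsub>M\<^esub> x) = a \<odot>\<^bsub>N\<^esub> f x)}"

text \<open>The ring \<^term>\<open>B\<close>, regarded as a module over the domain of a ring homomorphism
  \<^term>\<open>\<phi>\<close> into \<^term>\<open>B\<close>.\<close>

definition ring_module :: "('a \<Rightarrow> 'b) \<Rightarrow> ('b, 'm) ring_scheme \<Rightarrow> ('a, 'b) module"
  where "ring_module \<phi> B =
    \<lparr>carrier = carrier B, mult = mult B, one = one B, ring.zero = ring.zero B, ring.add = ring.add B,
     smult = (\<lambda>a x. \<phi> a \<otimes>\<^bsub>B\<^esub> x)\<rparr>"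

definition quotient_module :: "('a, 'm) ring_scheme \<Rightarrow> 'a set \<Rightarrow> ('a, 'a set) module"
  where "quotient_module A J = ring_module (\<lambda>a. J +>\<^bsub>A\<^esub> a) (A Quot J)"

definition extended_ideal :: "('b, 'm) ring_scheme \<Rightarrow> ('a \<Rightarrow> 'b) \<Rightarrow> 'a set \<Rightarrow> 'b set"
  where "extended_ideal B \<phi> I = genideal B (\<phi> ` I)"


section \<open>Tensor products\<close>

text \<open>The tensor product is the free abelian group on the set of pairs, modulo the subgroup
  generated by the usual bilinearity and balancing relations. Its elements are cosets.\<close>

definition tensor_free ::
  "('a, 'e, 'n) module_scheme \<Rightarrow> ('a, 'f, 'k) module_scheme \<Rightarrow> ('e \<times> 'f \<Rightarrow>\<^sub>0 int) monoid"
  where "tensor_free M N = free_Abelian_group (carrier M \<times> carrier N)"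

definition tensor_relations ::
  "('a, 'm) ring_scheme \<Rightarrow> ('a, 'e, 'n) module_scheme \<Rightarrow> ('a, 'f, 'k) module_scheme
    \<Rightarrow> ('e \<times> 'f \<Rightarrow>\<^sub>0 int) set"
  where "tensor_relations A M N = generate (tensor_free M N)
    ({frag_of (x \<oplus>\<^bsub>M\<^esub> x', y) - frag_of (x, y) - frag_of (x', y) | x x' y.
        x \<in> carrier M \<and> x' \<in> carrier M \<and> y \<in> carrier N} \<union>
     {frag_of (x, y \<oplus>\<^bsub>N\<^esub> y') - frag_of (x, y) - frag_of (x, y') | x y y'.
        x \<in> carrier M \<and> y \<in> carrier N \<and> y' \<in> carrier N} \<union>
     {frag_of (a \<odot>\<^bsub>M\<^esub> x, y) - frag_of (x, a \<odot>\<^bsub>N\<^esub> y) | a x y.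
        a \<in> carrier A \<and> x \<in> carrier M \<and> y \<in> carrier N})"

definition tensor_group ::
  "('a, 'm) ring_scheme \<Rightarrow> ('a, 'e, 'n) module_scheme \<Rightarrow> ('a, 'f, 'k) module_scheme
    \<Rightarrow> ('e \<times> 'f \<Rightarrow>\<^sub>0 int) set monoid"
  where "tensor_group A M N = tensor_free M N Mod tensor_relations A M N"

text \<open>The map \<open>f \<otimes> g\<close> into the tensor product of \<^term>\<open>M'\<close> and \<^term>\<open>N'\<close>. All members \<^term>\<open>c\<close>
  of a coset \<^term>\<open>X\<close> yield the same coset, so the union is that single coset.\<close>

definition tensor_map ::
  "('a, 'm) ring_scheme \<Rightarrow> ('a, 'e', 'n) module_scheme \<Rightarrow> ('a, 'f', 'k) module_scheme
    \<Rightarrow> ('e \<Rightarrow> 'e') \<Rightarrow> ('f \<Rightarrow> 'f') \<Rightarrow> ('e \<times> 'f \<Rightarrow>\<^sub>0 int) set \<Rightarrow> ('e' \<times> 'f' \<Rightarrow>\<^sub>0 int) set"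
  where "tensor_map A M' N' f g X =
    (\<Union>c\<in>X. tensor_relations A M' N' #>\<^bsub>tensor_free M' N'\<^esub>
              frag_extend (\<lambda>(x, y). frag_of (f x, g y)) c)"

text \<open>For a ring homomorphism \<^term>\<open>\<phi>\<close> from \<^term>\<open>A\<close> to \<^term>\<open>B\<close> and an \<^term>\<open>A\<close>-module
  \<^term>\<open>E\<close>, the \<^term>\<open>B\<close>-module \<open>E \<otimes>\<^sub>A B\<close>, on which \<^term>\<open>B\<close> acts through the right factor.
  The fields \<^const>\<open>mult\<close> and \<^const>\<open>one\<close> play no role in the locale \<^locale>\<open>module\<close>.\<close>

definition base_change ::
  "('a, 'm) ring_scheme \<Rightarrow> ('b, 'k) ring_scheme \<Rightarrow> ('a \<Rightarrow> 'b) \<Rightarrow> ('a, 'e, 'n) module_scheme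
    \<Rightarrow> ('b, ('e \<times> 'b \<Rightarrow>\<^sub>0 int) set) module"
  where "base_change A B \<phi> E =
    (let T = tensor_group A E (ring_module \<phi> B) in
     \<lparr>carrier = carrier T, mult = undefined, one = undefined,
      ring.zero = one T, ring.add = mult T,
      smult = (\<lambda>b. tensor_map A E (ring_module \<phi> B) (\<lambda>x. x) (\<lambda>t. b \<otimes>\<^bsub>B\<^esub> t))\<rparr>)"


section \<open>Flatness\<close>

text \<open>A module \<^term>\<open>N\<close> is flat if tensoring with \<^term>\<open>N\<close> preserves injectivity of module
  homomorphisms. HOL cannot quantify over all types inside a formula, so the test modules are those
  whose carrier lies in the type \<open>'u\<close> given as first argument. Whenever the carrier of \<^term>\<open>A\<close>
  embeds into \<open>'u\<close> this is flatness in the usual sense: the inclusions of ideals into \<^term>\<open>A\<close>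
  are then among the test maps up to isomorphism, and these already suffice (ideal criterion).
  For a smaller type \<open>'u\<close> the notion may be strictly weaker.\<close>

definition flat_module ::
  "'u itself \<Rightarrow> ('a, 'm) ring_scheme \<Rightarrow> ('a, 'f, 'k) module_scheme \<Rightarrow> bool"
  where "flat_module U A N \<longleftrightarrow> module A N \<and>
    (\<forall>(M :: ('a, 'u) module) (M' :: ('a, 'u) module) f.
       module A M \<and> module A M' \<and> f \<in> mod_hom A M M' \<and> inj_on f (carrier M) \<longrightarrow>
       inj_on (tensor_map A M' N f (\<lambda>y. y)) (carrier (tensor_group A M N)))"

definition flat_ring_hom ::
  "'u itself \<Rightarrow> ('a, 'm) ring_scheme \<Rightarrow> ('b, 'k) ring_scheme \<Rightarrow> ('a \<Rightarrow> 'b) \<Rightarrow> bool"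
  where "flat_ring_hom U A B \<phi> \<longleftrightarrow> \<phi> \<in> ring_hom A B \<and> flat_module U A (ring_module \<phi> B)"

end

theory Submission
  imports Defs
begin

text \<open>The comparison rests on two mechanisms: the Noetherian condition produces associated primes below a
  given prime, and flatness produces elements of \<open>E \<otimes> S\<close> with a prescribed annihilator.

  Over a Noetherian ring, if the annihilator of some \<open>x\<close> in a module lies in a prime \<open>P\<close>, then some
  associated prime of the module lies in \<open>P\<close> (\<open>Ass_below_prime\<close>): a maximal annihilator among those
  inside \<open>P\<close> is prime. For an \<open>R\<close>-module \<open>E\<close> this implies that every \<open>P\<close> in \<open>Ass (E \<otimes> S)\<close> contains
  the image of some \<open>\<qq>\<close> in \<open>Ass E\<close> (\<open>Ass_base_change_contracts\<close>); otherwise each element of \<open>E\<close> would be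
  killed by a scalar outside the contraction of \<open>P\<close>, hence so would each tensor. Applied to
  \<open>S / \<qq>S\<close>, it shows that every prime of \<open>S\<close> containing the image of \<open>\<qq>\<close> contains some
  associated prime of \<open>S / \<qq>S\<close>.

  If \<open>S\<close> is flat over \<open>R\<close>, then \<open>x \<otimes> s\<close> vanishes in \<open>E \<otimes> S\<close> exactly when \<open>s\<close> lies in the extension of
  the annihilator of \<open>x\<close> (\<open>pure_tensor_zero_iff\<close>). The inclusion \<open>R x \<subseteq> E\<close> stays injective after
  tensoring, and \<open>R x \<otimes> S\<close> is \<open>S\<close> modulo that extension. For \<open>\<pp>\<close> in \<open>Ass E\<close> two consequences follow:
  \<open>Ass (S / \<pp>S) \<subseteq> Ass (E \<otimes> S)\<close>, and every member of \<open>Ass (S / \<pp>S)\<close> contracts to \<open>\<pp>\<close>.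

  The theorem is then a statement about ordered sets. A minimal \<open>P\<close> in \<open>Ass (E \<otimes> S)\<close> contains the image of
  some \<open>\<pp>\<close>, so it contains, and therefore equals, a member of \<open>Ass (S / \<pp>S)\<close>; the same argument for any
  smaller \<open>\<qq>\<close> makes \<open>P\<close> a member of \<open>Ass (S / \<qq>S)\<close> too, and contracting gives \<open>\<qq> = \<pp>\<close>. Conversely,
  let \<open>P\<close> be minimal in \<open>Ass (S / \<pp>S)\<close> with \<open>\<pp>\<close> minimal. Any \<open>Q\<close> in \<open>Ass (E \<otimes> S)\<close> inside \<open>P\<close> contains a
  member of some \<open>Ass (S / \<qq>S)\<close>; contracting gives \<open>\<qq> \<subseteq> \<pp>\<close>, hence \<open>\<qq> = \<pp>\<close> and \<open>Q = P\<close>.\<close>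


section \<open>Annihilators and associated primes\<close>

lemma (in noetherian_ring) exists_maximal_ideal_in_family:
  assumes "C \<noteq> {}" and ideals: "\<And>I. I \<in> C \<Longrightarrow> ideal I R"
  obtains I where "I \<in> C" and "\<And>J. J \<in> C \<Longrightarrow> I \<subseteq> J \<Longrightarrow> J = I"
proof -
  have "\<Union>D \<in> C" if "D \<noteq> {}" "subset.chain C D" for D
  proof -
    have "subset.chain {I. ideal I R} D"
      using that(2) ideals by (auto simp: subset_chain_def)
    then show ?thesis
      using ideal_chain_is_trivial[OF that(1)] that(2) by (auto simp: subset_chain_def)
  qed
  then show thesis
    using subset_Zorn_nonempty[OF assms(1)] that by metis
qed

lemma (in module) annihilator_ideal:
  assumes "x \<in> carrier M"
  shows "ideal (annihilator R M x) R"
proof (rule idealI)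
  show "subgroup (annihilator R M x) (add_monoid R)"
  proof
    show "inv\<^bsub>add_monoid R\<^esub> a \<in> annihilator R M x" if "a \<in> annihilator R M x" for a
      using that assms smult_l_minus[of a x]
      by (simp add: annihilator_def flip: a_inv_def)
  qed (use assms in \<open>auto simp: annihilator_def smult_l_distr\<close>)
next
  fix a r
  assume a: "a \<in> annihilator R M x" and r: "r \<in> carrier R"
  then show "r \<otimes> a \<in> annihilator R M x"
    using assms by (simp add: annihilator_def smult_assoc1)
  with a r show "a \<otimes> r \<in> annihilator R M x"
    by (simp add: annihilator_def R.m_comm)
qed (simp add: R.ring_axioms)

lemma (in module) annihilator_smult_iff:
  assumes "x \<in> carrier M" "c \<in> carrier R"
  shows "a \<in> annihilator R M (c \<odot>\<^bsub>M\<^esub> x) \<longleftrightarrow> a \<in> carrier R \<and> a \<otimes> c \<in> annihilator R M x"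
  using assms by (auto simp: annihilator_def smult_assoc1)

text \<open>This is the global form of the fact that the localisation of the module at \<^term>\<open>P\<close>, being
  nonzero, has an associated prime. A maximal member \<open>I\<close> of the annihilators contained in \<^term>\<open>P\<close> does not
  grow when its element \<open>y\<close> is multiplied by a scalar, as long as the new annihilator stays inside
  \<^term>\<open>P\<close>. Scalars outside \<^term>\<open>P\<close> have this property, so they can be cancelled modulo \<open>I\<close>. If a
  scalar \<open>b\<close> does not have it, some scalar outside \<^term>\<open>P\<close> kills \<open>b y\<close>, and cancelling it puts \<open>b\<close>
  into \<open>I\<close>. Thus every \<open>b\<close> outside \<open>I\<close> can be cancelled, which is primality.\<close>

lemma (in module) Ass_below_prime:
  assumes noeth: "noetherian_ring R" and prime: "primeideal P R"
    and x: "x \<in> carrier M" and sub: "annihilator R M x \<subseteq> P"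
  obtains Q where "Q \<in> Ass R M" and "Q \<subseteq> P"
proof -
  interpret noetherian_ring R by fact
  interpret P: primeideal P R by fact
  define C where "C = {annihilator R M y | y. y \<in> carrier M \<and> annihilator R M y \<subseteq> P}"
  obtain I where "I \<in> C" and max: "\<And>J. J \<in> C \<Longrightarrow> I \<subseteq> J \<Longrightarrow> J = I"
    by (rule exists_maximal_ideal_in_family[of C])
      (use x sub annihilator_ideal in \<open>auto simp: C_def\<close>)
  then obtain y where y: "y \<in> carrier M" and I: "I = annihilator R M y" and IP: "I \<subseteq> P"
    by (auto simp: C_def)
  interpret I: ideal I R
    using annihilator_ideal[OF y] I by simp
  have absorb: "annihilator R M (c \<odot>\<^bsub>M\<^esub> y) = I"
    if c: "c \<in> carrier R" and "annihilator R M (c \<odot>\<^bsub>M\<^esub> y) \<subseteq> P" for c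
  proof (rule max)
    show "annihilator R M (c \<odot>\<^bsub>M\<^esub> y) \<in> C"
      using that y by (auto simp: C_def)
    show "I \<subseteq> annihilator R M (c \<odot>\<^bsub>M\<^esub> y)"
      using I y c I.I_r_closed by (auto simp: annihilator_smult_iff I.Icarr)
  qed
  have cancel: "a \<in> I" if a: "a \<in> carrier R" and s: "s \<in> carrier R" "s \<notin> P" and as: "a \<otimes> s \<in> I" for a s
  proof -
    have "annihilator R M (s \<odot>\<^bsub>M\<^esub> y) \<subseteq> P"
    proof
      fix b
      assume "b \<in> annihilator R M (s \<odot>\<^bsub>M\<^esub> y)"
      then have "b \<in> carrier R" "b \<otimes> s \<in> P"
        using IP[unfolded I] annihilator_smult_iff[OF y s(1)] by auto
      then show "b \<in> P"
        using P.I_prime s by blast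
    qed
    from absorb[OF s(1) this] show ?thesis
      using annihilator_smult_iff[OF y s(1), of a] a as[unfolded I] by simp
  qed
  have "primeideal I R"
  proof (rule primeidealI)
    show "carrier R \<noteq> I"
      using IP P.I_notcarr P.a_subset by blast
    fix a b
    assume ab: "a \<in> carrier R" "b \<in> carrier R" "a \<otimes> b \<in> I"
    show "a \<in> I \<or> b \<in> I"
    proof (rule disjCI)
      assume b: "b \<notin> I"
      have "annihilator R M (b \<odot>\<^bsub>M\<^esub> y) \<subseteq> P"
      proof
        fix s
        assume "s \<in> annihilator R M (b \<odot>\<^bsub>M\<^esub> y)"
        then have "s \<in> carrier R" "b \<otimes> s \<in> I"
          using ab(2) unfolding I annihilator_smult_iff[OF y ab(2)] by (auto simp: R.m_comm)
        then show "s \<in> P"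
          using cancel[OF ab(2)] b by blast
      qed
      from absorb[OF ab(2) this] show "a \<in> I"
        using annihilator_smult_iff[OF y ab(2), of a] ab(1) ab(3)[unfolded I] by simp
    qed
  qed (simp_all add: I.is_ideal R.is_cring)
  then have "I \<in> Ass R M"
    using y I by (auto simp: Ass_def)
  with IP that show thesis
    by blast
qed


section \<open>Residue class rings as modules\<close>

lemma ring_module_module:
  assumes "cring A" "cring B" "\<phi> \<in> ring_hom A B"
  shows "module A (ring_module \<phi> B)"
proof -
  interpret A: cring A by fact
  interpret B: cring B by fact
  interpret \<phi>: ring_hom_ring A B \<phi>
    using assms(3) A.ring_axioms B.ring_axioms by (intro ring_hom_ringI2)
  have "abelian_group (ring_module \<phi> B)"
  proof (rule abelian_groupI)
    show "\<exists>y\<in>carrier (ring_module \<phi> B). y \<oplus>\<^bsub>ring_module \<phi> B\<^esub> x = \<zero>\<^bsub>ring_module \<phi> B\<^esub>"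
      if "x \<in> carrier (ring_module \<phi> B)" for x
      using that B.l_neg B.a_inv_closed by (force simp: ring_module_def)
  qed (auto simp: ring_module_def B.a_assoc B.a_comm B.a_lcomm)
  then show ?thesis
    by (intro moduleI) (auto simp: ring_module_def B.l_distr B.r_distr B.m_assoc A.is_cring)
qed

lemma quotient_module_module:
  assumes "cring S" "ideal J S"
  shows "module S (quotient_module S J)"
proof -
  interpret ideal J S by fact
  show ?thesis
    unfolding quotient_module_def
    by (rule ring_module_module[OF assms(1) quotient_is_cring[OF assms(1)] rcos_ring_hom])
qed

lemma (in ideal) annihilator_quotient_module:
  assumes "s \<in> carrier R"
  shows "annihilator R (quotient_module R I) (I +> s) = {b \<in> carrier R. b \<otimes> s \<in> I}"
proof -
  have "b \<odot>\<^bsub>quotient_module R I\<^esub> (I +> s) = \<zero>\<^bsub>quotient_module R I\<^esub> \<longleftrightarrow> b \<otimes> s \<in> I"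
    if "b \<in> carrier R" for b
  proof -
    have "b \<odot>\<^bsub>quotient_module R I\<^esub> (I +> s) = I +> (b \<otimes> s)"
      using that assms by (simp add: quotient_module_def ring_module_def FactRing_def rcoset_mult_add)
    moreover have "\<zero>\<^bsub>quotient_module R I\<^esub> = I"
      by (simp add: quotient_module_def ring_module_def FactRing_def)
    moreover have "I +> (b \<otimes> s) = I \<longleftrightarrow> b \<otimes> s \<in> I"
      using rcos_const_imp_mem[of "b \<otimes> s"] a_rcos_zero[OF is_ideal, of "b \<otimes> s"] that assms by blast
    ultimately show ?thesis
      by simp
  qed
  then show ?thesis
    by (auto simp: annihilator_def)
qed

lemma (in ideal) carrier_quotient_module:
  "carrier (quotient_module R I) = {I +> s | s. s \<in> carrier R}"
  by (auto simp: quotient_module_def ring_module_def FactRing_def A_RCOSETS_def' a_r_coset_def')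

lemma (in ideal) Ass_quotient_moduleE:
  assumes "P \<in> Ass R (quotient_module R I)"
  obtains s where "primeideal P R" "s \<in> carrier R" "P = {b \<in> carrier R. b \<otimes> s \<in> I}"
  using assms by (auto simp: Ass_def carrier_quotient_module annihilator_quotient_module)

text \<open>The residue class of one has annihilator \<^term>\<open>I\<close>. This replaces the choice of a minimal prime
  over \<^term>\<open>I\<close> inside \<^term>\<open>P\<close>.\<close>

lemma (in ideal) Ass_quotient_module_below_prime:
  assumes "cring R" "noetherian_ring R" and prime: "primeideal P R" and IP: "I \<subseteq> P"
  obtains Q where "Q \<in> Ass R (quotient_module R I)" "Q \<subseteq> P"
proof -
  interpret Q: module R "quotient_module R I"
    using quotient_module_module assms(1) is_ideal .
  have "annihilator R (quotient_module R I) (I +> \<one>) \<subseteq> P"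
    using IP by (auto simp: annihilator_quotient_module)
  moreover have "I +> \<one> \<in> carrier (quotient_module R I)"
    by (auto simp: carrier_quotient_module)
  ultimately show thesis
    using Q.Ass_below_prime[OF assms(2) prime] that by blast
qed


section \<open>Relations in a tensor product\<close>

lemma keys_diff_subset:
  assumes "Poly_Mapping.keys c \<subseteq> X" "Poly_Mapping.keys d \<subseteq> X"
  shows "Poly_Mapping.keys (c - d :: 'a \<Rightarrow>\<^sub>0 int) \<subseteq> X"
  by (rule order_trans[OF keys_diff Un_least[OF assms]])

context
  fixes A :: "('a, 'm) ring_scheme" and M :: "('a, 'e, 'n) module_scheme"
    and N :: "('a, 'f, 'k) module_scheme"
  assumes M: "module A M" and N: "module A N"
begin

interpretation M: module A M by (rule M)
interpretation N: module A N by (rule N)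

lemma tensor_relations_subgroup: "subgroup (tensor_relations A M N) (tensor_free M N)"
  unfolding tensor_relations_def
proof (rule group.generate_is_subgroup)
  show "group (tensor_free M N)"
    by (simp add: tensor_free_def)
  show "{frag_of (x \<oplus>\<^bsub>M\<^esub> x', y) - frag_of (x, y) - frag_of (x', y) | x x' y.
        x \<in> carrier M \<and> x' \<in> carrier M \<and> y \<in> carrier N} \<union>
     {frag_of (x, y \<oplus>\<^bsub>N\<^esub> y') - frag_of (x, y) - frag_of (x, y') | x y y'.
        x \<in> carrier M \<and> y \<in> carrier N \<and> y' \<in> carrier N} \<union>
     {frag_of (a \<odot>\<^bsub>M\<^esub> x, y) - frag_of (x, a \<odot>\<^bsub>N\<^esub> y) | a x y.
        a \<in> carrier A \<and> x \<in> carrier M \<and> y \<in> carrier N} \<subseteq> carrier (tensor_free M N)"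
    by (auto simp: tensor_free_def keys_frag_of dest!: subsetD[OF keys_diff])
qed

text \<open>Additive maps out of a tensor product are handled without the tensor product: a property closed
  under differences and shared by the defining relations holds for all relations. Closure is only asked for
  elements supported on pairs from the carriers, where homomorphisms of the free group behave.\<close>

lemma tensor_relations_induct [consumes 1, case_names zero diff add_left add_right balanced]:
  assumes "c \<in> tensor_relations A M N"
    and zero: "Q 0"
    and diff: "\<And>c d. Poly_Mapping.keys c \<subseteq> carrier M \<times> carrier N \<Longrightarrow>
      Poly_Mapping.keys d \<subseteq> carrier M \<times> carrier N \<Longrightarrow> Q c \<Longrightarrow> Q d \<Longrightarrow> Q (c - d)"
    and add_left: "\<And>x x' y. x \<in> carrier M \<Longrightarrow> x' \<in> carrier M \<Longrightarrow> y \<in> carrier N \<Longrightarrow>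
      Q (frag_of (x \<oplus>\<^bsub>M\<^esub> x', y) - frag_of (x, y) - frag_of (x', y))"
    and add_right: "\<And>x y y'. x \<in> carrier M \<Longrightarrow> y \<in> carrier N \<Longrightarrow> y' \<in> carrier N \<Longrightarrow>
      Q (frag_of (x, y \<oplus>\<^bsub>N\<^esub> y') - frag_of (x, y) - frag_of (x, y'))"
    and balanced: "\<And>a x y. a \<in> carrier A \<Longrightarrow> x \<in> carrier M \<Longrightarrow> y \<in> carrier N \<Longrightarrow>
      Q (frag_of (a \<odot>\<^bsub>M\<^esub> x, y) - frag_of (x, a \<odot>\<^bsub>N\<^esub> y))"
  shows "Q c"
proof -
  let ?F = "tensor_free M N"
  interpret F: group ?F
    by (simp add: tensor_free_def)
  let ?H = "{c \<in> carrier ?F. Q c}"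
  have "subgroup ?H ?F"
  proof (rule F.subgroupI)
    show uminus: "inv\<^bsub>?F\<^esub> a \<in> ?H" if "a \<in> ?H" for a
      using that diff[OF _ _ zero, of a] by (auto simp: tensor_free_def)
    show "a \<otimes>\<^bsub>?F\<^esub> b \<in> ?H" if "a \<in> ?H" "b \<in> ?H" for a b
      using that uminus[OF that(2)] diff[of a "- b"] keys_diff_subset[of a _ "- b"] by (auto simp: tensor_free_def)
  qed (use zero in \<open>auto simp: tensor_free_def intro: exI[of _ 0]\<close>)
  then have "tensor_relations A M N \<subseteq> ?H"
    unfolding tensor_relations_def
    by (intro F.generate_subgroup_incl)
      (auto simp: tensor_free_def keys_frag_of intro!: add_left add_right balanced
        dest!: subsetD[OF keys_diff])
  with assms(1) show ?thesis
    by blast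
qed

lemma keys_tensor_relations:
  "c \<in> tensor_relations A M N \<Longrightarrow> Poly_Mapping.keys c \<subseteq> carrier M \<times> carrier N"
  using subgroup.mem_carrier[OF tensor_relations_subgroup] by (simp add: tensor_free_def)

lemma tensor_relations_zero: "0 \<in> tensor_relations A M N"
  using subgroup.one_closed[OF tensor_relations_subgroup] by (simp add: tensor_free_def)

lemma tensor_relations_add:
  "c \<in> tensor_relations A M N \<Longrightarrow> d \<in> tensor_relations A M N \<Longrightarrow> c + d \<in> tensor_relations A M N"
  using subgroup.m_closed[OF tensor_relations_subgroup] by (simp add: tensor_free_def)

lemma tensor_relations_diff:
  assumes "c \<in> tensor_relations A M N" "d \<in> tensor_relations A M N"
  shows "c - d \<in> tensor_relations A M N"
  using tensor_relations_add[OF assms(1), of "- d"]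
    subgroup.m_inv_closed[OF tensor_relations_subgroup assms(2)] keys_tensor_relations[OF assms(2)]
  by (simp add: tensor_free_def)

lemma tensor_relations_add_left:
  "x \<in> carrier M \<Longrightarrow> x' \<in> carrier M \<Longrightarrow> y \<in> carrier N \<Longrightarrow>
    frag_of (x \<oplus>\<^bsub>M\<^esub> x', y) - frag_of (x, y) - frag_of (x', y) \<in> tensor_relations A M N"
  unfolding tensor_relations_def by (rule generate.incl) blast

lemma tensor_relations_add_right:
  "x \<in> carrier M \<Longrightarrow> y \<in> carrier N \<Longrightarrow> y' \<in> carrier N \<Longrightarrow>
    frag_of (x, y \<oplus>\<^bsub>N\<^esub> y') - frag_of (x, y) - frag_of (x, y') \<in> tensor_relations A M N"
  unfolding tensor_relations_def by (rule generate.incl) blast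

lemma tensor_relations_balanced:
  "a \<in> carrier A \<Longrightarrow> x \<in> carrier M \<Longrightarrow> y \<in> carrier N \<Longrightarrow>
    frag_of (a \<odot>\<^bsub>M\<^esub> x, y) - frag_of (x, a \<odot>\<^bsub>N\<^esub> y) \<in> tensor_relations A M N"
  unfolding tensor_relations_def by (rule generate.incl) blast

lemma zero_tensor_relation:
  assumes "y \<in> carrier N"
  shows "frag_of (\<zero>\<^bsub>M\<^esub>, y) \<in> tensor_relations A M N"
  using tensor_relations_diff[OF tensor_relations_zero tensor_relations_add_left[of "\<zero>\<^bsub>M\<^esub>" "\<zero>\<^bsub>M\<^esub>" y]] assms
  by simp

lemma tensor_coset_eq_iff:
  assumes "Poly_Mapping.keys c \<subseteq> carrier M \<times> carrier N" "Poly_Mapping.keys d \<subseteq> carrier M \<times> carrier N"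
  shows "tensor_relations A M N #>\<^bsub>tensor_free M N\<^esub> c = tensor_relations A M N #>\<^bsub>tensor_free M N\<^esub> d
    \<longleftrightarrow> c - d \<in> tensor_relations A M N"
proof -
  interpret F: group "tensor_free M N"
    by (simp add: tensor_free_def)
  have car: "c \<in> carrier (tensor_free M N)" "d \<in> carrier (tensor_free M N)"
    using assms by (auto simp: tensor_free_def)
  have mem: "c \<in> tensor_relations A M N #>\<^bsub>tensor_free M N\<^esub> d \<longleftrightarrow> c - d \<in> tensor_relations A M N"
    by (auto simp: r_coset_def tensor_free_def) (metis diff_add_cancel)
  show ?thesis
    using F.repr_independence[OF _ car(2) tensor_relations_subgroup]
      F.repr_independenceD[OF tensor_relations_subgroup car(1)] mem by blast
qed

end

lemma tensor_relations_map:
  assumes mods: "module A M" "module A N" "module A M'" "module A N'"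
    and f: "f \<in> mod_hom A M M'" and g: "g \<in> mod_hom A N N'"
    and c: "c \<in> tensor_relations A M N"
  shows "frag_extend (\<lambda>(x, y). frag_of (f x, g y)) c \<in> tensor_relations A M' N'"
  using c
proof (induction rule: tensor_relations_induct[OF mods(1,2), consumes 1,
    case_names zero diff add_left add_right balanced])
  case zero
  show ?case
    using tensor_relations_zero mods by simp
next
  case (diff c d)
  then show ?case
    using tensor_relations_diff mods by (simp add: frag_extend_diff)
next
  case (add_left x x' y)
  then show ?case
    using f g tensor_relations_add_left[OF mods(3,4), of "f x" "f x'" "g y"]
    by (auto simp: frag_extend_diff mod_hom_def)
next
  case (add_right x y y')
  then show ?case
    using f g tensor_relations_add_right[OF mods(3,4), of "f x" "g y" "g y'"]
    by (auto simp: frag_extend_diff mod_hom_def)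
next
  case (balanced a x y)
  then show ?case
    using f g tensor_relations_balanced[OF mods(3,4), of a "f x" "g y"]
    by (auto simp: frag_extend_diff mod_hom_def)
qed

lemma keys_tensor_map:
  assumes "f \<in> mod_hom A M M'" "g \<in> mod_hom A N N'"
    and "Poly_Mapping.keys c \<subseteq> carrier M \<times> carrier N"
  shows "Poly_Mapping.keys (frag_extend (\<lambda>(x, y). frag_of (f x, g y)) c) \<subseteq> carrier M' \<times> carrier N'"
proof -
  have "Poly_Mapping.keys (case p of (x, y) \<Rightarrow> frag_of (f x, g y)) \<subseteq> carrier M' \<times> carrier N'"
    if "p \<in> Poly_Mapping.keys c" for p
    using that assms by (cases p) (auto simp: keys_frag_of mod_hom_def)
  then show ?thesis
    by (intro order_trans[OF keys_frag_extend] UN_least)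
qed

text \<open>The union over all members of a coset collapses, since the induced map of free groups preserves
  relations.\<close>

lemma tensor_map_coset:
  assumes mods: "module A M" "module A N" "module A M'" "module A N'"
    and f: "f \<in> mod_hom A M M'" and g: "g \<in> mod_hom A N N'"
    and c: "Poly_Mapping.keys c \<subseteq> carrier M \<times> carrier N"
  shows "tensor_map A M' N' f g (tensor_relations A M N #>\<^bsub>tensor_free M N\<^esub> c) =
    tensor_relations A M' N' #>\<^bsub>tensor_free M' N'\<^esub> frag_extend (\<lambda>(x, y). frag_of (f x, g y)) c"
proof -
  let ?F = "frag_extend (\<lambda>(x, y). frag_of (f x, g y))"
  have "tensor_relations A M' N' #>\<^bsub>tensor_free M' N'\<^esub> ?F d
      = tensor_relations A M' N' #>\<^bsub>tensor_free M' N'\<^esub> ?F c"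
    if d: "d \<in> tensor_relations A M N #>\<^bsub>tensor_free M N\<^esub> c" for d
  proof -
    from d obtain r where r: "r \<in> tensor_relations A M N" "d = r + c"
      by (auto simp: r_coset_def tensor_free_def)
    have "Poly_Mapping.keys d \<subseteq> carrier M \<times> carrier N"
      unfolding r(2) by (rule order_trans[OF keys_add Un_least[OF keys_tensor_relations[OF mods(1,2) r(1)] c]])
    moreover have "?F d - ?F c \<in> tensor_relations A M' N'"
      using tensor_relations_map[OF mods f g r(1)] r(2) by (simp add: frag_extend_add)
    ultimately show ?thesis
      using tensor_coset_eq_iff[OF mods(3,4)] keys_tensor_map[OF f g] c by blast
  qed
  moreover have "c \<in> tensor_relations A M N #>\<^bsub>tensor_free M N\<^esub> c"
    using tensor_relations_zero[OF mods(1,2)] by (force simp: r_coset_def tensor_free_def)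
  ultimately show ?thesis
    unfolding tensor_map_def by blast
qed

section \<open>Tensoring a cyclic module\<close>

lemma (in module) cyclic_submodule:
  assumes "x \<in> carrier M"
  shows "submodule {a \<odot>\<^bsub>M\<^esub> x | a. a \<in> carrier R} R M"
proof (rule submoduleI)
  let ?X = "{a \<odot>\<^bsub>M\<^esub> x | a. a \<in> carrier R}"
  show "\<zero>\<^bsub>M\<^esub> \<in> ?X"
    using assms smult_l_null R.zero_closed by (metis (mono_tags, lifting) mem_Collect_eq)
  show "\<ominus>\<^bsub>M\<^esub> y \<in> ?X" if "y \<in> ?X" for y
    using that assms smult_l_minus R.a_inv_closed by (smt (verit) mem_Collect_eq)
  show "y \<oplus>\<^bsub>M\<^esub> z \<in> ?X" if "y \<in> ?X" "z \<in> ?X" for y z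
    using that assms smult_l_distr R.a_closed by (smt (verit) mem_Collect_eq)
  show "a \<odot>\<^bsub>M\<^esub> y \<in> ?X" if "a \<in> carrier R" "y \<in> ?X" for a y
    using that assms smult_assoc1 R.m_closed by (smt (verit) mem_Collect_eq)
qed (use assms in auto)

text \<open>The map \<open>a x \<otimes> t \<mapsto> \<phi> a t\<close> from \<open>R x \<otimes> S\<close> to \<open>S / I S\<close>, with \<open>I\<close> the annihilator of \<^term>\<open>x\<close>, is well
  defined: two representatives \<open>a\<close> of the same element differ by an element of \<open>I\<close>. Choosing
  representatives gives a homomorphism \<open>h\<close> from the free group to \<^term>\<open>S\<close> that is bilinear only modulo
  the extension \<open>J\<close> of \<open>I\<close>; this suffices for \<open>h\<close> to send relations into \<open>J\<close>.\<close>

lemma cyclic_tensor_relation_imp_mem_extended_ideal: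
  fixes \<phi> :: "'r \<Rightarrow> 's"
  assumes "cring R" "cring S" and hom: "\<phi> \<in> ring_hom R S"
    and "module R M" and x: "x \<in> carrier M" and s: "s \<in> carrier S"
    and rel: "frag_of (x, s) \<in> tensor_relations R
      (M\<lparr>carrier := {a \<odot>\<^bsub>M\<^esub> x | a. a \<in> carrier R}\<rparr>) (ring_module \<phi> S)"
  shows "s \<in> extended_ideal S \<phi> (annihilator R M x)"
proof -
  interpret R: cring R by fact
  interpret S: cring S by fact
  interpret \<phi>: ring_hom_ring R S \<phi>
    using hom R.ring_axioms S.ring_axioms by (intro ring_hom_ringI2)
  interpret M: module R M by fact
  let ?X = "{a \<odot>\<^bsub>M\<^esub> x | a. a \<in> carrier R}"
  let ?M = "M\<lparr>carrier := ?X\<rparr>" and ?N = "ring_module \<phi> S"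
  define J where "J = extended_ideal S \<phi> (annihilator R M x)"
  have img: "\<phi> ` annihilator R M x \<subseteq> carrier S"
    by (auto simp: annihilator_def)
  interpret J: ideal J S
    unfolding J_def extended_ideal_def using img by (rule S.genideal_ideal)
  have diff_J: "\<phi> a \<otimes>\<^bsub>S\<^esub> t \<ominus>\<^bsub>S\<^esub> \<phi> b \<otimes>\<^bsub>S\<^esub> t \<in> J"
    if ab: "a \<in> carrier R" "b \<in> carrier R" and eq: "a \<odot>\<^bsub>M\<^esub> x = b \<odot>\<^bsub>M\<^esub> x" and t: "t \<in> carrier S" for a b t
  proof -
    have "(a \<ominus>\<^bsub>R\<^esub> b) \<odot>\<^bsub>M\<^esub> x = \<zero>\<^bsub>M\<^esub>"
      using ab eq x by (simp add: R.minus_eq M.smult_l_distr M.smult_l_minus M.r_neg)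
    then have "\<phi> (a \<ominus>\<^bsub>R\<^esub> b) \<in> J"
      unfolding J_def extended_ideal_def
      using S.genideal_self[OF img] ab by (auto simp: annihilator_def)
    then have "\<phi> (a \<ominus>\<^bsub>R\<^esub> b) \<otimes>\<^bsub>S\<^esub> t \<in> J"
      using J.I_r_closed t by blast
    then show ?thesis
      using ab t by (simp add: R.minus_eq S.minus_eq S.l_distr S.l_minus)
  qed
  define rep where "rep y = (SOME a. a \<in> carrier R \<and> a \<odot>\<^bsub>M\<^esub> x = y)" for y
  have rep: "rep y \<in> carrier R \<and> rep y \<odot>\<^bsub>M\<^esub> x = y" if "y \<in> ?X" for y
    unfolding rep_def by (rule someI_ex) (use that in auto)
  obtain h where h: "h \<in> hom (free_Abelian_group (?X \<times> carrier S)) (add_monoid S)"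
    and h_of: "\<And>z. z \<in> ?X \<times> carrier S \<Longrightarrow> h (frag_of z) = (\<lambda>(y, t). \<phi> (rep y) \<otimes>\<^bsub>S\<^esub> t) z"
    by (rule comm_group.free_Abelian_group_universal[OF S.a_comm_group,
        of "\<lambda>(y, t). \<phi> (rep y) \<otimes>\<^bsub>S\<^esub> t" "?X \<times> carrier S"])
      (use rep \<phi>.hom_closed S.m_closed in fastforce)+
  interpret h: group_hom "free_Abelian_group (?X \<times> carrier S)" "add_monoid S" h
    using h S.add.group_axioms by (simp add: group_hom_def group_hom_axioms_def)
  have h_diff: "h (c - d) = h c \<ominus>\<^bsub>S\<^esub> h d"
    if "Poly_Mapping.keys c \<subseteq> ?X \<times> carrier S" "Poly_Mapping.keys d \<subseteq> ?X \<times> carrier S" for c d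
    using that h.hom_mult[of c "- d"] h.hom_inv[of d] by (simp add: S.minus_eq a_inv_def)
  interpret X: module R ?M
    by (rule submodule.submodule_is_module[OF M.cyclic_submodule[OF x]]) fact
  have N: "module R ?N"
    using ring_module_module[OF \<open>cring R\<close> \<open>cring S\<close> hom] .
  have carN: "carrier ?N = carrier S" and addN: "add ?N = add S"
    and smultN: "\<And>a t. a \<odot>\<^bsub>?N\<^esub> t = \<phi> a \<otimes>\<^bsub>S\<^esub> t"
    by (simp_all add: ring_module_def)
  have "h c \<in> J" if "c \<in> tensor_relations R ?M ?N" for c
    using that
  proof (induction rule: tensor_relations_induct[OF X.module_axioms N, consumes 1,
      case_names zero diff add_left add_right balanced])
    case zero
    show ?case
      using h.hom_one by simp
  next
    case (diff c d)
    then show ?case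
      by (simp add: carN h_diff S.minus_eq)
  next
    case (add_left y y' t)
    then have t: "t \<in> carrier S" and y: "y \<in> ?X" "y' \<in> ?X" "y \<oplus>\<^bsub>M\<^esub> y' \<in> ?X"
      using X.a_closed by (auto simp: carN)
    have "\<phi> (rep (y \<oplus>\<^bsub>M\<^esub> y')) \<otimes>\<^bsub>S\<^esub> t \<ominus>\<^bsub>S\<^esub> \<phi> (rep y \<oplus>\<^bsub>R\<^esub> rep y') \<otimes>\<^bsub>S\<^esub> t \<in> J"
      using rep[OF y(1)] rep[OF y(2)] rep[OF y(3)] x t by (intro diff_J) (auto simp: M.smult_l_distr)
    moreover have "h (frag_of (y \<oplus>\<^bsub>M\<^esub> y', t) - frag_of (y, t) - frag_of (y', t)) =
      \<phi> (rep (y \<oplus>\<^bsub>M\<^esub> y')) \<otimes>\<^bsub>S\<^esub> t \<ominus>\<^bsub>S\<^esub> \<phi> (rep y) \<otimes>\<^bsub>S\<^esub> t \<ominus>\<^bsub>S\<^esub> \<phi> (rep y') \<otimes>\<^bsub>S\<^esub> t"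
      using y t by (subst h_diff keys_diff_subset; simp add: h_of keys_frag_of keys_diff_subset)+
    ultimately show ?case
      using rep[OF y(1)] rep[OF y(2)] rep[OF y(3)] t
      by (simp add: S.minus_eq S.l_distr S.minus_add S.a_assoc)
  next
    case (add_right y t t')
    then have t: "t \<in> carrier S" "t' \<in> carrier S" and y: "y \<in> ?X"
      by (auto simp: carN)
    have "h (frag_of (y, t \<oplus>\<^bsub>S\<^esub> t') - frag_of (y, t) - frag_of (y, t')) =
      \<phi> (rep y) \<otimes>\<^bsub>S\<^esub> (t \<oplus>\<^bsub>S\<^esub> t') \<ominus>\<^bsub>S\<^esub> \<phi> (rep y) \<otimes>\<^bsub>S\<^esub> t \<ominus>\<^bsub>S\<^esub> \<phi> (rep y) \<otimes>\<^bsub>S\<^esub> t'"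
      using y t by (subst h_diff keys_diff_subset; simp add: h_of keys_frag_of keys_diff_subset)+
    also have "\<dots> = \<zero>\<^bsub>S\<^esub>"
      using rep[OF y] t by (simp add: S.minus_eq S.r_distr S.a_comm S.a_lcomm S.r_neg S.r_neg1 S.r_neg2)
    finally show ?case
      by (simp add: addN)
  next
    case (balanced a y t)
    then have a: "a \<in> carrier R" and t: "t \<in> carrier S" and y: "y \<in> ?X" "a \<odot>\<^bsub>M\<^esub> y \<in> ?X"
      using X.smult_closed by (auto simp: carN)
    \<comment> \<open>Both \<^term>\<open>rep (a \<odot>\<^bsub>M\<^esub> y)\<close> and \<^term>\<open>a \<otimes>\<^bsub>R\<^esub> rep y\<close> represent \<^term>\<open>a \<odot>\<^bsub>M\<^esub> y\<close>.\<close>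
    have "\<phi> (rep (a \<odot>\<^bsub>M\<^esub> y)) \<otimes>\<^bsub>S\<^esub> t \<ominus>\<^bsub>S\<^esub> \<phi> (a \<otimes>\<^bsub>R\<^esub> rep y) \<otimes>\<^bsub>S\<^esub> t \<in> J"
      using rep[OF y(1)] rep[OF y(2)] a x t by (intro diff_J) (auto simp: M.smult_assoc1)
    moreover have "\<phi> (a \<otimes>\<^bsub>R\<^esub> rep y) \<otimes>\<^bsub>S\<^esub> t = \<phi> (rep y) \<otimes>\<^bsub>S\<^esub> (\<phi> a \<otimes>\<^bsub>S\<^esub> t)"
      using rep[OF y(1)] a t by (simp add: S.m_ac)
    moreover have "h (frag_of (a \<odot>\<^bsub>M\<^esub> y, t) - frag_of (y, \<phi> a \<otimes>\<^bsub>S\<^esub> t)) =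
      \<phi> (rep (a \<odot>\<^bsub>M\<^esub> y)) \<otimes>\<^bsub>S\<^esub> t \<ominus>\<^bsub>S\<^esub> \<phi> (rep y) \<otimes>\<^bsub>S\<^esub> (\<phi> a \<otimes>\<^bsub>S\<^esub> t)"
      using a y t by (subst h_diff; simp add: h_of keys_frag_of)
    ultimately show ?case
      by (simp add: smultN)
  qed
  moreover have xX: "x \<in> ?X"
    using M.smult_one[OF x] R.one_closed by (metis (mono_tags, lifting) mem_Collect_eq)
  ultimately have in_J: "\<phi> (rep x) \<otimes>\<^bsub>S\<^esub> s \<in> J"
    using rel s h_of[of "(x, s)"] by fastforce
  \<comment> \<open>The chosen representative of \<^term>\<open>x\<close> need not be \<^term>\<open>\<one>\<^bsub>R\<^esub>\<close>.\<close>
  have "\<phi> (rep x) \<otimes>\<^bsub>S\<^esub> s \<ominus>\<^bsub>S\<^esub> \<phi> \<one>\<^bsub>R\<^esub> \<otimes>\<^bsub>S\<^esub> s \<in> J"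
    using rep[OF xX] x s by (intro diff_J) auto
  with in_J have "\<phi> (rep x) \<otimes>\<^bsub>S\<^esub> s \<ominus>\<^bsub>S\<^esub> (\<phi> (rep x) \<otimes>\<^bsub>S\<^esub> s \<ominus>\<^bsub>S\<^esub> \<phi> \<one>\<^bsub>R\<^esub> \<otimes>\<^bsub>S\<^esub> s) \<in> J"
    by (simp add: S.minus_eq)
  also have "\<phi> (rep x) \<otimes>\<^bsub>S\<^esub> s \<ominus>\<^bsub>S\<^esub> (\<phi> (rep x) \<otimes>\<^bsub>S\<^esub> s \<ominus>\<^bsub>S\<^esub> \<phi> \<one>\<^bsub>R\<^esub> \<otimes>\<^bsub>S\<^esub> s) = s"
    using rep[OF xX] s by (simp add: S.minus_eq S.minus_add S.r_neg2)
  finally show ?thesis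
    by (simp add: J_def)
qed


section \<open>Flatness and inclusions of submodules\<close>

text \<open>Flatness makes the map induced by the inclusion injective, and on representatives this map does
  nothing; so a combination of pairs from the submodule that vanishes in the large tensor product already
  vanishes in the small one.\<close>

lemma flat_submodule_tensor_relation:
  fixes M :: "('a, 'u) module"
  assumes flat: "flat_module TYPE('u) A N" and M: "module A M" and X: "submodule X A M"
    and keys: "Poly_Mapping.keys c \<subseteq> X \<times> carrier N" and c: "c \<in> tensor_relations A M N"
  shows "c \<in> tensor_relations A (M\<lparr>carrier := X\<rparr>) N"
proof -
  let ?X = "M\<lparr>carrier := X\<rparr>"
  have N: "module A N"
    using flat by (simp add: flat_module_def)
  have MX: "module A ?X"
    using submodule.submodule_is_module[OF X M] .
  have sub: "X \<subseteq> carrier M"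
    using module.submoduleE(1)[OF M X] .
  have incl: "(\<lambda>x. x) \<in> mod_hom A ?X M" and id: "(\<lambda>y. y) \<in> mod_hom A N N"
    using sub by (auto simp: mod_hom_def)
  have inj: "inj_on (tensor_map A M N (\<lambda>x. x) (\<lambda>y. y)) (carrier (tensor_group A ?X N))"
    using flat M MX incl by (auto simp: flat_module_def)
  let ?coset = "\<lambda>c. tensor_relations A ?X N #>\<^bsub>tensor_free ?X N\<^esub> c"
  have map: "tensor_map A M N (\<lambda>x. x) (\<lambda>y. y) (?coset d) = tensor_relations A M N #>\<^bsub>tensor_free M N\<^esub> d"
    if "Poly_Mapping.keys d \<subseteq> X \<times> carrier N" for d
    using tensor_map_coset[OF MX N M N incl id, of d] that frag_expansion[of d]
    by (simp add: case_prod_unfold)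
  have mem: "?coset d \<in> carrier (tensor_group A ?X N)" if "Poly_Mapping.keys d \<subseteq> X \<times> carrier N" for d
    using that by (auto simp: tensor_group_def FactGroup_def RCOSETS_def tensor_free_def)
  have "tensor_relations A M N #>\<^bsub>tensor_free M N\<^esub> c = tensor_relations A M N #>\<^bsub>tensor_free M N\<^esub> 0"
    using tensor_coset_eq_iff[OF M N, of c 0] c keys_tensor_relations[OF M N c] by simp
  then have "?coset c = ?coset 0"
    using inj_onD[OF inj _ mem mem, of c 0] map[of c] map[of 0] keys by simp
  then show ?thesis
    using tensor_coset_eq_iff[OF MX N, of c 0] keys by simp
qed

text \<open>Flatness is tested on modules whose elements have one fixed type. Wrapping elements in
  \<^const>\<open>Inr\<close> turns a module over the second summand of a sum type into an isomorphic test module.\<close>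

definition sum_copy :: "('a, 'e, 'n) module_scheme \<Rightarrow> ('a, 'c + 'e) module"
  where "sum_copy E =
    \<lparr>carrier = Inr ` carrier E, mult = undefined, one = undefined, ring.zero = Inr \<zero>\<^bsub>E\<^esub>,
     ring.add = (\<lambda>u v. Inr (projr u \<oplus>\<^bsub>E\<^esub> projr v)), smult = (\<lambda>a u. Inr (a \<odot>\<^bsub>E\<^esub> projr u))\<rparr>"

lemma module_sum_copy:
  assumes "module A E"
  shows "module A (sum_copy E)"
proof -
  interpret module A E by fact
  have "abelian_group (sum_copy E)"
  proof (rule abelian_groupI)
    show "\<exists>v\<in>carrier (sum_copy E). v \<oplus>\<^bsub>sum_copy E\<^esub> u = \<zero>\<^bsub>sum_copy E\<^esub>"
      if "u \<in> carrier (sum_copy E)" for u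
      using that M.l_neg M.a_inv_closed by (force simp: sum_copy_def)
  qed (auto simp: sum_copy_def M.a_assoc M.a_comm M.a_lcomm)
  then show ?thesis
    by (intro moduleI) (auto simp: sum_copy_def smult_l_distr smult_r_distr smult_assoc1 R.is_cring)
qed

lemma Inr_mod_hom_sum_copy: "Inr \<in> mod_hom A E (sum_copy E)"
  by (auto simp: mod_hom_def sum_copy_def)

lemma annihilator_sum_copy: "annihilator A (sum_copy E) (Inr x) = annihilator A E x"
  by (auto simp: annihilator_def sum_copy_def)


section \<open>Annihilators in a base change\<close>

locale base_change_data = R: cring R + S: cring S + \<phi>: ring_hom_ring R S \<phi> + E: module R E
  for R :: "('r, 'm) ring_scheme" and S :: "('s, 'k) ring_scheme" and \<phi> :: "'r \<Rightarrow> 's"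
    and E :: "('r, 'e, 'n) module_scheme"
begin

abbreviation N :: "('r, 's) module" where "N \<equiv> ring_module \<phi> S"
abbreviation rels where "rels \<equiv> tensor_relations R E N"
abbreviation coset where "coset c \<equiv> rels #>\<^bsub>tensor_free E N\<^esub> c"
abbreviation scale where "scale b \<equiv> frag_extend (\<lambda>(x, t). frag_of (x, b \<otimes>\<^bsub>S\<^esub> t))"

lemma module_N: "module R N"
  using ring_module_module[OF R.is_cring S.is_cring \<phi>.homh] .

lemma N_simps [simp]:
  "carrier N = carrier S" "add N = add S" "a \<odot>\<^bsub>N\<^esub> t = \<phi> a \<otimes>\<^bsub>S\<^esub> t"
  by (simp_all add: ring_module_def)

lemma mult_mod_hom:
  assumes "b \<in> carrier S"
  shows "(\<lambda>t. b \<otimes>\<^bsub>S\<^esub> t) \<in> mod_hom R N N"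
  using assms by (auto simp: mod_hom_def S.r_distr S.m_lcomm)

lemma id_mod_hom: "(\<lambda>x. x) \<in> mod_hom R E E"
  by (auto simp: mod_hom_def)

lemma scale_rels: "b \<in> carrier S \<Longrightarrow> c \<in> rels \<Longrightarrow> scale b c \<in> rels"
  using tensor_relations_map[OF E.module_axioms module_N E.module_axioms module_N id_mod_hom mult_mod_hom] .

lemma scale_scale:
  assumes "a \<in> carrier S" "b \<in> carrier S" "Poly_Mapping.keys c \<subseteq> carrier E \<times> carrier S"
  shows "scale a (scale b c) = scale (a \<otimes>\<^bsub>S\<^esub> b) c"
  using assms(3)
proof (induction c rule: free_Abelian_group_induct[consumes 1, case_names zero diff of])
  case (of z)
  then show ?case
    using assms by (auto simp: S.m_assoc)
qed (simp_all add: frag_extend_diff)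

lemma carrier_base_change:
  "carrier (base_change R S \<phi> E) = {coset c | c. Poly_Mapping.keys c \<subseteq> carrier E \<times> carrier S}"
  by (auto simp: base_change_def Let_def tensor_group_def FactGroup_def RCOSETS_def tensor_free_def)

lemma annihilator_coset:
  assumes c: "Poly_Mapping.keys c \<subseteq> carrier E \<times> carrier S"
  shows "annihilator S (base_change R S \<phi> E) (coset c) = {b \<in> carrier S. scale b c \<in> rels}"
proof -
  have "b \<odot>\<^bsub>base_change R S \<phi> E\<^esub> coset c = \<zero>\<^bsub>base_change R S \<phi> E\<^esub> \<longleftrightarrow> scale b c \<in> rels"
    if b: "b \<in> carrier S" for b
  proof -
    have "b \<odot>\<^bsub>base_change R S \<phi> E\<^esub> coset c = coset (scale b c)"
      using tensor_map_coset[OF E.module_axioms module_N E.module_axioms module_N id_mod_hom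
          mult_mod_hom[OF b], of c] c by (simp add: base_change_def Let_def)
    moreover have "\<zero>\<^bsub>base_change R S \<phi> E\<^esub> = coset 0"
      using group.coset_mult_one[of "tensor_free E N" rels]
        subgroup.subset[OF tensor_relations_subgroup[OF E.module_axioms module_N]]
      by (simp add: base_change_def Let_def tensor_group_def FactGroup_def tensor_free_def)
    moreover have "Poly_Mapping.keys (scale b c) \<subseteq> carrier E \<times> carrier S"
      using keys_tensor_map[OF id_mod_hom mult_mod_hom[OF b], of c] c by simp
    ultimately show ?thesis
      using tensor_coset_eq_iff[OF E.module_axioms module_N, of "scale b c" 0] by simp
  qed
  then show ?thesis
    by (auto simp: annihilator_def)
qed

lemma extended_ideal_ideal:
  assumes "I \<subseteq> carrier R"
  shows "ideal (extended_ideal S \<phi> I) S"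
  unfolding extended_ideal_def by (rule S.genideal_ideal) (use assms in auto)

lemma extended_ideal_subset_iff:
  assumes "I \<subseteq> carrier R" "ideal J S"
  shows "extended_ideal S \<phi> I \<subseteq> J \<longleftrightarrow> \<phi> ` I \<subseteq> J"
  unfolding extended_ideal_def using assms \<phi>.hom_closed
  by (intro S.Idl_subset_ideal) auto

text \<open>The \<open>s\<close> with \<open>x \<otimes> s = 0\<close> form an ideal of \<^term>\<open>S\<close>, and \<open>x \<otimes> \<phi> a = a x \<otimes> 1\<close> puts the image of
  the annihilator of \<^term>\<open>x\<close> into it.\<close>

lemma pure_tensor_zero:
  assumes x: "x \<in> carrier E" and s: "s \<in> extended_ideal S \<phi> (annihilator R E x)"
  shows "frag_of (x, s) \<in> rels"
proof -
  note mods = E.module_axioms module_N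
  let ?K = "{t \<in> carrier S. frag_of (x, t) \<in> rels}"
  have zero: "frag_of (x, \<zero>\<^bsub>S\<^esub>) \<in> rels"
    using tensor_relations_diff[OF mods tensor_relations_zero[OF mods]
        tensor_relations_add_right[OF mods, of x "\<zero>\<^bsub>S\<^esub>" "\<zero>\<^bsub>S\<^esub>"]] x by simp
  have add: "frag_of (x, t \<oplus>\<^bsub>S\<^esub> u) \<in> rels"
    if "t \<in> carrier S" "frag_of (x, t) \<in> rels" "u \<in> carrier S" "frag_of (x, u) \<in> rels" for t u
    using tensor_relations_add[OF mods tensor_relations_add[OF mods
        tensor_relations_add_right[OF mods, of x t u] that(4)] that(2)] that x by simp
  have mult: "frag_of (x, b \<otimes>\<^bsub>S\<^esub> t) \<in> rels"
    if "b \<in> carrier S" "frag_of (x, t) \<in> rels" for b t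
    using scale_rels[OF that] by simp
  have "ideal ?K S"
  proof (rule idealI)
    show "subgroup ?K (add_monoid S)"
    proof (rule S.add.subgroupI)
      fix t
      assume t: "t \<in> ?K"
      then have "frag_of (x, (\<ominus>\<^bsub>S\<^esub> \<one>\<^bsub>S\<^esub>) \<otimes>\<^bsub>S\<^esub> t) \<in> rels"
        using mult by simp
      then show "\<ominus>\<^bsub>S\<^esub> t \<in> ?K"
        using t by (simp add: S.l_minus)
    qed (use zero add in auto)
    show "t \<otimes>\<^bsub>S\<^esub> b \<in> ?K" if "t \<in> ?K" "b \<in> carrier S" for t b
      using that mult[of b t] by (simp add: S.m_comm)
  qed (use mult S.ring_axioms in auto)
  moreover have "\<phi> ` annihilator R E x \<subseteq> ?K"
  proof (rule image_subsetI)
    fix a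
    assume "a \<in> annihilator R E x"
    then have a: "a \<in> carrier R" "a \<odot>\<^bsub>E\<^esub> x = \<zero>\<^bsub>E\<^esub>"
      by (auto simp: annihilator_def)
    have "frag_of (\<zero>\<^bsub>E\<^esub>, \<one>\<^bsub>S\<^esub>) - frag_of (x, \<phi> a) \<in> rels"
      using tensor_relations_balanced[OF mods, of a x "\<one>\<^bsub>S\<^esub>"] a x by simp
    then show "\<phi> a \<in> ?K"
      using tensor_relations_diff[OF mods zero_tensor_relation[OF mods, of "\<one>\<^bsub>S\<^esub>"]] a by fastforce
  qed
  ultimately show ?thesis
    using extended_ideal_subset_iff[of "annihilator R E x" ?K] s by (auto simp: annihilator_def)
qed

text \<open>Let \<open>\<pp>\<close> be the contraction of \<^term>\<open>P\<close>. If no associated prime of \<^term>\<open>E\<close> lies in \<open>\<pp>\<close>, then every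
  element of \<^term>\<open>E\<close> is killed by some scalar outside \<open>\<pp>\<close>; multiplying finitely many of these scalars
  kills any given tensor, including the one whose annihilator is \<^term>\<open>P\<close>.\<close>

lemma Ass_base_change_contracts:
  assumes noeth: "noetherian_ring R" and P: "P \<in> Ass S (base_change R S \<phi> E)"
  obtains \<qq> where "\<qq> \<in> Ass R E" and "\<phi> ` \<qq> \<subseteq> P"
proof (rule ccontr)
  assume "\<not> thesis"
  with that have none: "\<not> (\<phi> ` \<qq> \<subseteq> P)" if "\<qq> \<in> Ass R E" for \<qq>
    using that by blast
  note mods = E.module_axioms module_N
  from P obtain c where prime: "primeideal P S" and c: "Poly_Mapping.keys c \<subseteq> carrier E \<times> carrier S"
    and ann: "P = {b \<in> carrier S. scale b c \<in> rels}"
    by (auto simp: Ass_def carrier_base_change annihilator_coset)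
  define \<pp> where "\<pp> = {a \<in> carrier R. \<phi> a \<in> P}"
  have "primeideal \<pp> R"
    unfolding \<pp>_def by (rule \<phi>.primeideal_vimage) (fact R.is_cring, fact prime)
  then interpret \<pp>: primeideal \<pp> R .
  have kill: "\<exists>a\<in>carrier R - \<pp>. a \<odot>\<^bsub>E\<^esub> x = \<zero>\<^bsub>E\<^esub>" if x: "x \<in> carrier E" for x
  proof (rule ccontr)
    assume "\<not> ?thesis"
    then have "annihilator R E x \<subseteq> \<pp>"
      by (auto simp: annihilator_def)
    then obtain \<qq> where "\<qq> \<in> Ass R E" "\<qq> \<subseteq> \<pp>"
      using E.Ass_below_prime[OF noeth \<pp>.primeideal x] by blast
    then show False
      using none[of \<qq>] unfolding \<pp>_def by blast
  qed
  have "\<exists>a\<in>carrier R - \<pp>. scale (\<phi> a) c \<in> rels"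
    using c
  proof (induction c rule: free_Abelian_group_induct[consumes 1, case_names zero diff of])
    case zero
    obtain a where "a \<in> carrier R - \<pp>"
      using \<pp>.I_notcarr \<pp>.a_subset by blast
    then show ?case
      using tensor_relations_zero[OF mods] by (intro bexI[of _ a]) simp_all
  next
    case (diff c d)
    then obtain a b where a: "a \<in> carrier R - \<pp>" "scale (\<phi> a) c \<in> rels"
      and b: "b \<in> carrier R - \<pp>" "scale (\<phi> b) d \<in> rels"
      by blast
    have "a \<otimes>\<^bsub>R\<^esub> b \<in> carrier R - \<pp>"
      using a(1) b(1) \<pp>.I_prime by blast
    moreover have "scale (\<phi> (a \<otimes>\<^bsub>R\<^esub> b)) (c - d) \<in> rels"
    proof -
      have "scale (\<phi> (a \<otimes>\<^bsub>R\<^esub> b)) c = scale (\<phi> b) (scale (\<phi> a) c)"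
        "scale (\<phi> (a \<otimes>\<^bsub>R\<^esub> b)) d = scale (\<phi> a) (scale (\<phi> b) d)"
        using a(1) b(1) diff.hyps by (simp_all add: scale_scale S.m_comm)
      then show ?thesis
        using a b scale_rels tensor_relations_diff[OF mods] by (simp add: frag_extend_diff)
    qed
    ultimately show ?case
      by blast
  next
    case (of z)
    then obtain x t where z: "z = (x, t)" and x: "x \<in> carrier E" and t: "t \<in> carrier S"
      by auto
    from kill[OF x] obtain a where a: "a \<in> carrier R - \<pp>" "a \<odot>\<^bsub>E\<^esub> x = \<zero>\<^bsub>E\<^esub>"
      by blast
    have "frag_of (\<zero>\<^bsub>E\<^esub>, t) - frag_of (x, \<phi> a \<otimes>\<^bsub>S\<^esub> t) \<in> rels"
      using tensor_relations_balanced[OF mods, of a x t] a x t by simp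
    then have "frag_of (x, \<phi> a \<otimes>\<^bsub>S\<^esub> t) \<in> rels"
      using tensor_relations_diff[OF mods zero_tensor_relation[OF mods, of t]] t by force
    with a(1) z show ?case
      by auto
  qed
  then show False
    unfolding \<pp>_def ann using \<phi>.hom_closed by blast
qed

end


section \<open>Associated primes of the fibres of a flat base change\<close>

text \<open>A free first summand \<^typ>\<open>'c\<close> lets the results apply to every type of test modules that contains
  a copy of the element type of \<^term>\<open>E\<close> as a summand.\<close>

locale flat_base_change = base_change_data R S \<phi> E
  for R :: "('r, 'm) ring_scheme" and S :: "('s, 'k) ring_scheme" and \<phi> :: "'r \<Rightarrow> 's"
    and E :: "('r, 'e, 'n) module_scheme" +
  fixes c_type :: "'c itself"
  assumes flat: "flat_module TYPE('c + 'e) R N"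
begin

text \<open>By flatness \<open>R x \<otimes> S\<close> embeds into \<open>E \<otimes> S\<close>, so the question is decided in the cyclic module, where
  the answer is known. The copy of \<^term>\<open>E\<close> serves to make both modules admissible for the flatness test.\<close>

lemma pure_tensor_zero_iff:
  assumes x: "x \<in> carrier E" and s: "s \<in> carrier S"
  shows "frag_of (x, s) \<in> rels \<longleftrightarrow> s \<in> extended_ideal S \<phi> (annihilator R E x)"
proof
  assume rel: "frag_of (x, s) \<in> rels"
  let ?E = "sum_copy E :: ('r, 'c + 'e) module"
  let ?x = "Inr x :: 'c + 'e"
  interpret E': module R ?E
    by (rule module_sum_copy[OF E.module_axioms])
  have x': "?x \<in> carrier ?E"
    using x by (simp add: sum_copy_def)
  have "(\<lambda>t. t) \<in> mod_hom R N N"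
    by (auto simp: mod_hom_def)
  from tensor_relations_map[OF E.module_axioms module_N E'.module_axioms module_N Inr_mod_hom_sum_copy this rel]
  have "frag_of (?x, s) \<in> tensor_relations R ?E N"
    by simp
  moreover have "?x \<in> {a \<odot>\<^bsub>?E\<^esub> ?x | a. a \<in> carrier R}"
    using E'.smult_one[OF x'] R.one_closed by (metis (mono_tags, lifting) mem_Collect_eq)
  ultimately have "frag_of (?x, s) \<in> tensor_relations R (?E\<lparr>carrier := {a \<odot>\<^bsub>?E\<^esub> ?x | a. a \<in> carrier R}\<rparr>) N"
    using s by (intro flat_submodule_tensor_relation[OF flat E'.module_axioms E'.cyclic_submodule[OF x']])
      (auto simp: keys_frag_of)
  from cyclic_tensor_relation_imp_mem_extended_ideal[OF R.is_cring S.is_cring \<phi>.homh E'.module_axioms x' s this]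
  show "s \<in> extended_ideal S \<phi> (annihilator R E x)"
    by (simp add: annihilator_sum_copy)
qed (rule pure_tensor_zero[OF x])

text \<open>If \<^term>\<open>\<pp>\<close> is the annihilator of \<open>x\<close>, then \<open>x \<otimes> s\<close> has the same annihilator as the residue
  class of \<open>s\<close> in \<open>S / \<pp>S\<close>: this is the embedding of \<open>S / \<pp>S\<close> into \<open>E \<otimes> S\<close>.\<close>

lemma Ass_fibre_subset_Ass_base_change:
  assumes \<pp>: "\<pp> \<in> Ass R E"
  shows "Ass S (quotient_module S (extended_ideal S \<phi> \<pp>)) \<subseteq> Ass S (base_change R S \<phi> E)"
proof
  fix P
  assume P: "P \<in> Ass S (quotient_module S (extended_ideal S \<phi> \<pp>))"
  from \<pp> obtain x where x: "x \<in> carrier E" and ann: "\<pp> = annihilator R E x"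
    by (auto simp: Ass_def)
  interpret I: ideal "extended_ideal S \<phi> \<pp>" S
    by (rule extended_ideal_ideal) (auto simp: ann annihilator_def)
  from I.Ass_quotient_moduleE[OF P] obtain s where prime: "primeideal P S" and s: "s \<in> carrier S"
    and P_eq: "P = {b \<in> carrier S. b \<otimes>\<^bsub>S\<^esub> s \<in> extended_ideal S \<phi> \<pp>}" .
  have keys: "Poly_Mapping.keys (frag_of (x, s)) \<subseteq> carrier E \<times> carrier S"
    using x s by (simp add: keys_frag_of)
  have "P = annihilator S (base_change R S \<phi> E) (coset (frag_of (x, s)))"
    using pure_tensor_zero_iff[OF x] s by (auto simp: annihilator_coset[OF keys] P_eq ann)
  then show "P \<in> Ass S (base_change R S \<phi> E)"
    using prime keys unfolding Ass_def carrier_base_change by blast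
qed

text \<open>A scalar outside \<^term>\<open>\<pp>\<close> is a nonzerodivisor on \<open>R / \<pp>\<close>, hence by flatness on \<open>S / \<pp>S\<close>. In terms
  of an element \<open>x\<close> of \<^term>\<open>E\<close> with annihilator \<^term>\<open>\<pp>\<close>: for \<open>a\<close> outside \<^term>\<open>\<pp>\<close> the element \<open>a x\<close> still
  has annihilator \<^term>\<open>\<pp>\<close>, so \<open>x \<otimes> \<phi> a s = a x \<otimes> s\<close> vanishes only if \<open>s\<close> lies in \<open>\<pp>S\<close>.\<close>

lemma Ass_fibre_lies_over:
  assumes \<pp>: "\<pp> \<in> Ass R E" and P: "P \<in> Ass S (quotient_module S (extended_ideal S \<phi> \<pp>))"
  shows "{a \<in> carrier R. \<phi> a \<in> P} = \<pp>"
proof -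
  from \<pp> obtain x where "primeideal \<pp> R" and x: "x \<in> carrier E" and ann: "\<pp> = annihilator R E x"
    by (auto simp: Ass_def)
  interpret \<pp>: primeideal \<pp> R by fact
  interpret I: ideal "extended_ideal S \<phi> \<pp>" S
    by (rule extended_ideal_ideal) (rule \<pp>.a_subset)
  from I.Ass_quotient_moduleE[OF P] obtain s where "primeideal P S" and s: "s \<in> carrier S"
    and P_eq: "P = {b \<in> carrier S. b \<otimes>\<^bsub>S\<^esub> s \<in> extended_ideal S \<phi> \<pp>}" .
  interpret P: primeideal P S by fact
  have s_notin: "s \<notin> extended_ideal S \<phi> \<pp>"
  proof
    assume "s \<in> extended_ideal S \<phi> \<pp>"
    then have "P = carrier S"
      using I.I_l_closed[of s] unfolding P_eq by blast
    with P.I_notcarr show False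
      by simp
  qed
  show ?thesis
  proof (intro equalityI subsetI)
    fix a
    assume "a \<in> {a \<in> carrier R. \<phi> a \<in> P}"
    then have a: "a \<in> carrier R" and as: "\<phi> a \<otimes>\<^bsub>S\<^esub> s \<in> extended_ideal S \<phi> \<pp>"
      unfolding P_eq by blast+
    show "a \<in> \<pp>"
    proof (rule ccontr)
      assume "a \<notin> \<pp>"
      then have ann': "annihilator R E (a \<odot>\<^bsub>E\<^esub> x) = \<pp>"
        using \<pp>.I_prime[OF _ a] \<pp>.I_r_closed[OF _ a] \<pp>.Icarr E.annihilator_smult_iff[OF x a]
        unfolding ann[symmetric] by blast
      have "frag_of (a \<odot>\<^bsub>E\<^esub> x, s) - frag_of (x, \<phi> a \<otimes>\<^bsub>S\<^esub> s) \<in> rels"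
        using tensor_relations_balanced[OF E.module_axioms module_N, of a x s] a x s by simp
      moreover have "frag_of (x, \<phi> a \<otimes>\<^bsub>S\<^esub> s) \<in> rels"
        using pure_tensor_zero[OF x] as by (simp add: ann)
      ultimately have "frag_of (a \<odot>\<^bsub>E\<^esub> x, s) \<in> rels"
        using tensor_relations_add[OF E.module_axioms module_N] by fastforce
      then have "s \<in> extended_ideal S \<phi> \<pp>"
        using pure_tensor_zero_iff[of "a \<odot>\<^bsub>E\<^esub> x" s] a x s ann' by simp
      with s_notin show False ..
    qed
  next
    fix a
    assume a: "a \<in> \<pp>"
    then have "\<phi> a \<in> extended_ideal S \<phi> \<pp>"
      using extended_ideal_subset_iff[OF \<pp>.a_subset I.is_ideal] by blast
    then show "a \<in> {a \<in> carrier R. \<phi> a \<in> P}"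
      using I.I_r_closed[OF _ s] \<pp>.Icarr[OF a] \<phi>.hom_closed unfolding P_eq by blast
  qed
qed

end


section \<open>Minimal associated primes of a flat base change\<close>

theorem proposition2p2:
  fixes R :: "'r ring" and S :: "'s ring" and \<phi> :: "'r \<Rightarrow> 's" and E :: "('r, 'e) module"
  assumes "cring R" and "noetherian_ring R"
    and "cring S" and "noetherian_ring S"
    and "flat_ring_hom TYPE('r set + 'e) R S \<phi>"
    and "module R E"
  shows "min_Ass S (base_change R S \<phi> E) =
    (\<Union>\<pp> \<in> min_Ass R E. min_Ass S (quotient_module S (extended_ideal S \<phi> \<pp>)))"
proof -
  interpret R: cring R by fact
  interpret S: cring S by fact
  have hom: "\<phi> \<in> ring_hom R S" and flat: "flat_module TYPE('r set + 'e) R (ring_module \<phi> S)"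
    using assms(5) by (simp_all add: flat_ring_hom_def)
  interpret \<phi>: ring_hom_ring R S \<phi>
    using hom R.ring_axioms S.ring_axioms by (intro ring_hom_ringI2)
  interpret E: module R E by fact
  interpret flat_base_change R S \<phi> E "TYPE('r set)"
    by unfold_locales (rule flat)
  let ?T = "base_change R S \<phi> E"
  let ?fibre = "\<lambda>\<pp>. quotient_module S (extended_ideal S \<phi> \<pp>)"
  have below: "\<exists>Q \<in> Ass S (?fibre \<qq>). Q \<subseteq> P"
    if \<qq>: "\<qq> \<in> Ass R E" "\<phi> ` \<qq> \<subseteq> P" and P: "primeideal P S" for \<qq> P
  proof -
    have "\<qq> \<subseteq> carrier R"
      using \<qq>(1) by (auto simp: Ass_def annihilator_def)
    note ideal = extended_ideal_ideal[OF this]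
    have "extended_ideal S \<phi> \<qq> \<subseteq> P"
      using extended_ideal_subset_iff[OF \<open>\<qq> \<subseteq> carrier R\<close> primeideal.axioms(1)[OF P]] \<qq>(2) by simp
    then show ?thesis
      using ideal.Ass_quotient_module_below_prime[OF ideal assms(3,4) P] by blast
  qed
  show ?thesis
  proof (intro equalityI subsetI)
    fix P
    assume "P \<in> min_Ass S ?T"
    then have P: "P \<in> Ass S ?T" and min: "\<And>Q. Q \<in> Ass S ?T \<Longrightarrow> Q \<subseteq> P \<Longrightarrow> Q = P"
      by (auto simp: min_Ass_def)
    then have prime: "primeideal P S"
      by (simp add: Ass_def)
    \<comment> \<open>The prime found below \<^term>\<open>P\<close> is associated to \<^term>\<open>?T\<close>, so minimality identifies it with \<^term>\<open>P\<close>.\<close>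
    have fibre: "P \<in> Ass S (?fibre \<qq>)" if "\<qq> \<in> Ass R E" "\<phi> ` \<qq> \<subseteq> P" for \<qq>
      using below[OF that prime] min Ass_fibre_subset_Ass_base_change[OF that(1)] by blast
    obtain \<pp> where \<pp>: "\<pp> \<in> Ass R E" "\<phi> ` \<pp> \<subseteq> P"
      using Ass_base_change_contracts[OF assms(2) P] .
    have "\<qq> = \<pp>" if "\<qq> \<in> Ass R E" "\<qq> \<subseteq> \<pp>" for \<qq>
    proof -
      have "\<phi> ` \<qq> \<subseteq> P"
        using that(2) \<pp>(2) by blast
      then show ?thesis
        using Ass_fibre_lies_over[OF that(1) fibre[OF that(1)]]
          Ass_fibre_lies_over[OF \<pp>(1) fibre[OF \<pp>]] by simp
    qed
    then have "\<pp> \<in> min_Ass R E"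
      using \<pp>(1) by (auto simp: min_Ass_def)
    moreover have "P \<in> min_Ass S (?fibre \<pp>)"
      using fibre[OF \<pp>] min Ass_fibre_subset_Ass_base_change[OF \<pp>(1)] by (auto simp: min_Ass_def)
    ultimately show "P \<in> (\<Union>\<pp> \<in> min_Ass R E. min_Ass S (?fibre \<pp>))"
      by blast
  next
    fix P
    assume "P \<in> (\<Union>\<pp> \<in> min_Ass R E. min_Ass S (?fibre \<pp>))"
    then obtain \<pp> where \<pp>: "\<pp> \<in> Ass R E" and \<pp>_min: "\<And>\<qq>. \<qq> \<in> Ass R E \<Longrightarrow> \<qq> \<subseteq> \<pp> \<Longrightarrow> \<qq> = \<pp>"
      and P: "P \<in> Ass S (?fibre \<pp>)" and min: "\<And>Q. Q \<in> Ass S (?fibre \<pp>) \<Longrightarrow> Q \<subseteq> P \<Longrightarrow> Q = P"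
      by (auto simp: min_Ass_def)
    have "Q = P" if Q: "Q \<in> Ass S ?T" and QP: "Q \<subseteq> P" for Q
    proof -
      obtain \<qq> where \<qq>: "\<qq> \<in> Ass R E" "\<phi> ` \<qq> \<subseteq> Q"
        using Ass_base_change_contracts[OF assms(2) Q] .
      obtain Q' where Q': "Q' \<in> Ass S (?fibre \<qq>)" "Q' \<subseteq> Q"
        using below[OF \<qq>] Q by (auto simp: Ass_def)
      have "\<qq> \<subseteq> \<pp>"
        using Ass_fibre_lies_over[OF \<qq>(1) Q'(1)] Ass_fibre_lies_over[OF \<pp> P] Q'(2) QP by blast
      then have "\<qq> = \<pp>"
        by (rule \<pp>_min[OF \<qq>(1)])
      then have "Q' = P"
        using min[of Q'] Q' QP by blast
      with Q'(2) QP show ?thesis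
        by blast
    qed
    then show "P \<in> min_Ass S ?T"
      using P Ass_fibre_subset_Ass_base_change[OF \<pp>] by (auto simp: min_Ass_def)
  qed
qed

end
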